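(* There is no non-trivial (i.e. no non-zero) invariant bilinear form on the extended Schrödinger-Virasoro Lie algebra $\widetilde{\mathfrak{sv}}$.
   Context: The extended Schrödinger-Virasoro Lie algebra $\widetilde{\mathfrak{sv}}$ is the complex Lie algebra with basis $\{L_n, M_n, N_n, Y_{n+\frac12} \mid n\in\mathbb{Z}\}$ and brackets, for all $m,n\in\mathbb{Z}$: $[L_m,L_n]=(n-m)L_{m+n}$, $[M_m,M_n]=0$, $[N_m,N_n]=0$, $[Y_{m+\frac12},Y_{n+\frac12}]=(m-n)M_{m+n+1}$, $[L_m,M_n]=nM_{m+n}$, $[L_m,N_n]=nN_{m+n}$, $[L_m,Y_{n+\frac12}]=\left(n+\frac{1-m}{2}\right)Y_{m+n+\frac12}$, $[N_m,M_n]=2M_{m+n}$, $[N_m,Y_{n+\frac12}]=Y_{m+n+\frac12}$, $[M_m,Y_{n+\frac12}]=0$. A bilinear form $f:\mathfrak{g}\times\mathfrak{g}\to\mathbb{C}$ on a complex Lie algebra $\mathfrak{g}$ (not assumed symmetric) is called invariant if $f([x,y],z)=f(x,[y,z])$ for all $x,y,z\in\mathfrak{g}$. *)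

theory Defs
  imports Complex_Main "HOL-Library.Poly_Mapping"
begin

section \<open>Lie algebras and invariant bilinear forms over the complex numbers\<close>

definition bilinear_map ::
  "(complex \<Rightarrow> 'a::ab_group_add \<Rightarrow> 'a) \<Rightarrow> (complex \<Rightarrow> 'b::ab_group_add \<Rightarrow> 'b)
    \<Rightarrow> ('a \<Rightarrow> 'a \<Rightarrow> 'b) \<Rightarrow> bool" where
  "bilinear_map s t B \<longleftrightarrow>
     (\<forall>x. Vector_Spaces.linear s t (\<lambda>y. B x y)) \<and> (\<forall>y. Vector_Spaces.linear s t (\<lambda>x. B x y))"

locale complex_lie_algebra = vector_space scale
  for scale :: "complex \<Rightarrow> 'a::ab_group_add \<Rightarrow> 'a" +
  fixes bracket :: "'a \<Rightarrow> 'a \<Rightarrow> 'a"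
  assumes bracket_bilinear: "bilinear_map scale scale bracket"
    and bracket_alternating: "bracket x x = 0"
    and bracket_jacobi:
      "bracket x (bracket y z) + bracket y (bracket z x) + bracket z (bracket x y) = 0"

definition bilinear_form ::
  "(complex \<Rightarrow> 'a::ab_group_add \<Rightarrow> 'a) \<Rightarrow> ('a \<Rightarrow> 'a \<Rightarrow> complex) \<Rightarrow> bool" where
  "bilinear_form s f \<longleftrightarrow> bilinear_map s (*) f"

definition invariant_form :: "('a \<Rightarrow> 'a \<Rightarrow> 'a) \<Rightarrow> ('a \<Rightarrow> 'a \<Rightarrow> complex) \<Rightarrow> bool" where
  "invariant_form bracket f \<longleftrightarrow> (\<forall>x y z. f (bracket x y) z = f x (bracket y z))"


section \<open>The extended Schroedinger-Virasoro Lie algebra\<close>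

text \<open>The underlying space consists of the finitely supported complex functions on the index set
  below. The index \<open>idxY n\<close> belongs to the basis vector with half-integer subscript
  \<open>n + 1/2\<close>.\<close>

datatype sv_index = idxL int | idxM int | idxN int | idxY int

type_synonym sv = "sv_index \<Rightarrow>\<^sub>0 complex"

definition sv_scale :: "complex \<Rightarrow> sv \<Rightarrow> sv" where
  "sv_scale c x = Poly_Mapping.map ((*) c) x"

definition sv_basis :: "sv_index \<Rightarrow> sv" where
  "sv_basis i = Poly_Mapping.single i 1"

abbreviation sv_L :: "int \<Rightarrow> sv" where "sv_L n \<equiv> sv_basis (idxL n)"
abbreviation sv_M :: "int \<Rightarrow> sv" where "sv_M n \<equiv> sv_basis (idxM n)"
abbreviation sv_N :: "int \<Rightarrow> sv" where "sv_N n \<equiv> sv_basis (idxN n)"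
abbreviation sv_Y :: "int \<Rightarrow> sv" where "sv_Y n \<equiv> sv_basis (idxY n)"

text \<open>The subscripts \<open>m + 1/2\<close> and \<open>n + 1/2\<close> add up to \<open>m + n + 1\<close>. The equations for the pairs
  \<open>(M,L)\<close>, \<open>(N,L)\<close>, \<open>(Y,L)\<close>, \<open>(M,N)\<close>, \<open>(Y,N)\<close> and \<open>(Y,M)\<close> are forced by antisymmetry.\<close>

fun sv_basis_bracket :: "sv_index \<Rightarrow> sv_index \<Rightarrow> sv" where
  "sv_basis_bracket (idxL m) (idxL n) = sv_scale (of_int (n - m)) (sv_L (m + n))"
| "sv_basis_bracket (idxM m) (idxM n) = 0"
| "sv_basis_bracket (idxN m) (idxN n) = 0"
| "sv_basis_bracket (idxY m) (idxY n) = sv_scale (of_int (m - n)) (sv_M (m + n + 1))"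
| "sv_basis_bracket (idxL m) (idxM n) = sv_scale (of_int n) (sv_M (m + n))"
| "sv_basis_bracket (idxL m) (idxN n) = sv_scale (of_int n) (sv_N (m + n))"
| "sv_basis_bracket (idxL m) (idxY n) =
     sv_scale (of_int n + (1 - of_int m) / 2) (sv_Y (m + n))"
| "sv_basis_bracket (idxN m) (idxM n) = sv_scale 2 (sv_M (m + n))"
| "sv_basis_bracket (idxN m) (idxY n) = sv_Y (m + n)"
| "sv_basis_bracket (idxM m) (idxY n) = 0"
| "sv_basis_bracket (idxM n) (idxL m) = - sv_scale (of_int n) (sv_M (m + n))"
| "sv_basis_bracket (idxN n) (idxL m) = - sv_scale (of_int n) (sv_N (m + n))"
| "sv_basis_bracket (idxY n) (idxL m) =
     - sv_scale (of_int n + (1 - of_int m) / 2) (sv_Y (m + n))"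
| "sv_basis_bracket (idxM n) (idxN m) = - sv_scale 2 (sv_M (m + n))"
| "sv_basis_bracket (idxY n) (idxN m) = - sv_Y (m + n)"
| "sv_basis_bracket (idxY n) (idxM m) = 0"

definition sv_bracket :: "sv \<Rightarrow> sv \<Rightarrow> sv" where
  "sv_bracket x y =
     (\<Sum>i\<in>Poly_Mapping.keys x. \<Sum>j\<in>Poly_Mapping.keys y.
        sv_scale (Poly_Mapping.lookup x i * Poly_Mapping.lookup y j) (sv_basis_bracket i j))"


section \<open>The construction yields a Lie algebra with the prescribed basis and brackets\<close>

lemma lookup_sv_scale [simp]:
  "Poly_Mapping.lookup (sv_scale c x) i = c * Poly_Mapping.lookup x i"
  by (simp add: sv_scale_def Poly_Mapping.map.rep_eq when_def)

lemma lookup_sv_basis: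
  "Poly_Mapping.lookup (sv_basis i) j = (if i = j then 1 else 0)"
  by (simp add: sv_basis_def lookup_single when_def)

interpretation sv: vector_space sv_scale
  by unfold_locales (auto intro!: poly_mapping_eqI simp: lookup_add algebra_simps)

lemma sv_expand:
  "x = (\<Sum>i\<in>Poly_Mapping.keys x. sv_scale (Poly_Mapping.lookup x i) (sv_basis i))"
  by (rule poly_mapping_eqI)
    (simp add: lookup_sum lookup_sv_basis if_distrib [of "\<lambda>c. _ * c"] in_keys_iff cong: if_cong)

lemma inj_sv_basis: "inj sv_basis"
  by (rule injI) (metis lookup_sv_basis zero_neq_one)

lemma sv_span_basis: "sv.span (range sv_basis) = UNIV"
proof -
  have "x \<in> sv.span (range sv_basis)" for x
    by (subst sv_expand) (intro sv.span_sum sv.span_scale sv.span_base rangeI)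
  then show ?thesis by auto
qed

lemma sv_independent_basis: "sv.independent (range sv_basis)"
proof -
  have "u b = 0" if t: "finite t" "t \<subseteq> range sv_basis" "(\<Sum>v\<in>t. sv_scale (u v) v) = 0" "b \<in> t"
    for t u b
  proof -
    obtain i where i: "b = sv_basis i" using t by auto
    have *: "Poly_Mapping.lookup v i = (if v = b then 1 else 0)" if "v \<in> t" for v
      using t(2) that by (auto simp: i lookup_sv_basis inj_eq [OF inj_sv_basis])
    have "0 = Poly_Mapping.lookup (\<Sum>v\<in>t. sv_scale (u v) v) i" using t by simp
    also have "\<dots> = (\<Sum>v\<in>t. if v = b then u v else 0)"
      unfolding lookup_sum
      by (intro sum.cong) (auto simp: *)
    also have "\<dots> = u b" using t by simp
    finally show ?thesis by simp
  qed
  then show ?thesis unfolding sv.independent_explicit_module by blast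
qed

lemma sv_bracket_superset:
  assumes "finite A" "finite B" "Poly_Mapping.keys x \<subseteq> A" "Poly_Mapping.keys y \<subseteq> B"
  shows "sv_bracket x y =
     (\<Sum>i\<in>A. \<Sum>j\<in>B.
        sv_scale (Poly_Mapping.lookup x i * Poly_Mapping.lookup y j) (sv_basis_bracket i j))"
proof -
  have "sv_bracket x y =
     (\<Sum>i\<in>Poly_Mapping.keys x. \<Sum>j\<in>B.
        sv_scale (Poly_Mapping.lookup x i * Poly_Mapping.lookup y j) (sv_basis_bracket i j))"
    unfolding sv_bracket_def using assms
    by (intro sum.cong refl sum.mono_neutral_left) (auto simp: in_keys_iff)
  also have "\<dots> = (\<Sum>i\<in>A. \<Sum>j\<in>B.
        sv_scale (Poly_Mapping.lookup x i * Poly_Mapping.lookup y j) (sv_basis_bracket i j))"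
    using assms by (intro sum.mono_neutral_left) (auto simp: in_keys_iff)
  finally show ?thesis .
qed

lemma sv_bracket_basis [simp]: "sv_bracket (sv_basis i) (sv_basis j) = sv_basis_bracket i j"
  by (simp add: sv_bracket_def sv_basis_def)

lemma sv_bracket_bilinear: "bilinear_map sv_scale sv_scale sv_bracket"
proof -
  let ?k = Poly_Mapping.keys
  have addl: "sv_bracket (x + y) z = sv_bracket x z + sv_bracket y z" for x y z
    using keys_add [of x y]
    by (simp add: sv_bracket_superset [of "?k x \<union> ?k y" "?k z"] lookup_add distrib_right
        sv.scale_left_distrib sum.distrib)
  have addr: "sv_bracket z (x + y) = sv_bracket z x + sv_bracket z y" for x y z
    using keys_add [of x y]
    by (simp add: sv_bracket_superset [of "?k z" "?k x \<union> ?k y"] lookup_add distrib_left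
        sv.scale_left_distrib sum.distrib)
  have keys: "?k (sv_scale c x) \<subseteq> ?k x" for c x by (auto simp: in_keys_iff)
  have scl: "sv_bracket (sv_scale c x) z = sv_scale c (sv_bracket x z)" for c x z
    using keys [of c x]
    by (simp add: sv_bracket_superset [of "?k x" "?k z"] sv.scale_sum_right mult.assoc)
  have scr: "sv_bracket z (sv_scale c x) = sv_scale c (sv_bracket z x)" for c x z
    using keys [of c x]
    by (simp add: sv_bracket_superset [of "?k z" "?k x"] sv.scale_sum_right mult_ac)
  show ?thesis unfolding bilinear_map_def
    by (intro conjI allI; unfold_locales) (simp_all add: addl addr scl scr)
qed

lemma sv_induct [case_names zero add scale basis]:
  assumes "P 0" "\<And>x y. P x \<Longrightarrow> P y \<Longrightarrow> P (x + y)" "\<And>c x. P x \<Longrightarrow> P (sv_scale c x)"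
    and "\<And>i. P (sv_basis i)"
  shows "P x"
proof -
  have "P (\<Sum>i\<in>A. sv_scale (u i) (sv_basis i))" for A u
    by (induction A rule: infinite_finite_induct) (use assms in auto)
  then show ?thesis by (subst sv_expand)
qed

lemma
  shows sv_bracket_zero_left [simp]: "sv_bracket 0 z = 0"
    and sv_bracket_zero_right [simp]: "sv_bracket z 0 = 0"
    and sv_bracket_minus_left [simp]: "sv_bracket (- x) z = - sv_bracket x z"
    and sv_bracket_minus_right [simp]: "sv_bracket z (- x) = - sv_bracket z x"
    and sv_bracket_add_left: "sv_bracket (x + y) z = sv_bracket x z + sv_bracket y z"
    and sv_bracket_add_right: "sv_bracket z (x + y) = sv_bracket z x + sv_bracket z y"
    and sv_bracket_scale_left [simp]: "sv_bracket (sv_scale c x) z = sv_scale c (sv_bracket x z)"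
    and sv_bracket_scale_right [simp]: "sv_bracket z (sv_scale c x) = sv_scale c (sv_bracket z x)"
    and sv_bracket_diff_left: "sv_bracket (x - y) z = sv_bracket x z - sv_bracket y z"
    and sv_bracket_diff_right: "sv_bracket z (x - y) = sv_bracket z x - sv_bracket z y"
proof -
  interpret l: Vector_Spaces.linear sv_scale sv_scale "\<lambda>x. sv_bracket x z"
    using sv_bracket_bilinear by (simp add: bilinear_map_def)
  interpret r: Vector_Spaces.linear sv_scale sv_scale "\<lambda>x. sv_bracket z x"
    using sv_bracket_bilinear by (simp add: bilinear_map_def)
  show "sv_bracket 0 z = 0" "sv_bracket z 0 = 0"
    "sv_bracket (- x) z = - sv_bracket x z" "sv_bracket z (- x) = - sv_bracket z x"
    "sv_bracket (x + y) z = sv_bracket x z + sv_bracket y z"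
    "sv_bracket z (x + y) = sv_bracket z x + sv_bracket z y"
    "sv_bracket (sv_scale c x) z = sv_scale c (sv_bracket x z)"
    "sv_bracket z (sv_scale c x) = sv_scale c (sv_bracket z x)"
    "sv_bracket (x - y) z = sv_bracket x z - sv_bracket y z"
    "sv_bracket z (x - y) = sv_bracket z x - sv_bracket z y"
    by (simp_all add: l.zero r.zero l.neg r.neg l.add r.add l.scale r.scale l.diff r.diff)
qed

lemma sv_bracket_antisym: "sv_bracket x y = - sv_bracket y x"
proof (induction x rule: sv_induct)
  case (basis i)
  show ?case
  proof (induction y rule: sv_induct)
    case (basis j)
    show ?case
      by (cases i; cases j)
        (auto intro!: poly_mapping_eqI simp: lookup_sv_basis algebra_simps)
  qed (simp_all add: sv_bracket_add_left sv_bracket_add_right)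
qed (simp_all add: sv_bracket_add_left sv_bracket_add_right)

lemma sv_jacobi:
  "sv_bracket x (sv_bracket y z) + sv_bracket y (sv_bracket z x) + sv_bracket z (sv_bracket x y) = 0"
  (is "?J x y z = 0")
proof -
  define J where "J = (\<lambda>x y z. ?J x y z)"
  have add: "J (x + x') y z = J x y z + J x' y z" for x x' y z
    by (simp add: J_def sv_bracket_add_left sv_bracket_add_right)
  have scale: "J (sv_scale c x) y z = sv_scale c (J x y z)" for c x y z
    by (simp add: J_def sv.scale_right_distrib)
  have zero: "J 0 y z = 0" for y z
    by (simp add: J_def)
  have rot: "J x y z = J z x y" for x y z
    by (simp add: J_def add_ac)
  have "J (sv_basis i) (sv_basis j) (sv_basis k) = 0" for i j k
    unfolding J_def
    by (cases i; cases j; cases k)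
      (auto intro!: poly_mapping_eqI simp: lookup_add lookup_minus lookup_sv_basis field_simps
          sv_bracket_add_right sv_bracket_diff_right)
  then have "J x (sv_basis j) (sv_basis k) = 0" for x j k
    by (induction x rule: sv_induct) (simp_all add: add scale zero)
  then have "J (sv_basis j) (sv_basis k) x = 0" "J (sv_basis k) x (sv_basis j) = 0" for x j k
    by (metis rot)+
  then have "J y (sv_basis k) x = 0" for x y k
    by (induction y rule: sv_induct) (simp_all add: add scale zero)
  then have "J (sv_basis k) x y = 0" for x y k
    by (metis rot)
  then have "J z x y = 0" for x y z
    by (induction z rule: sv_induct) (simp_all add: add scale zero)
  then show ?thesis by (simp add: J_def)
qed

theorem sv_lie_algebra: "complex_lie_algebra sv_scale sv_bracket"
proof unfold_locales
  show "sv_bracket x x = 0" for x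
  proof (rule poly_mapping_eqI)
    fix i
    have "Poly_Mapping.lookup (sv_bracket x x) i = - Poly_Mapping.lookup (sv_bracket x x) i"
      by (subst sv_bracket_antisym) simp
    then show "Poly_Mapping.lookup (sv_bracket x x) i = Poly_Mapping.lookup 0 i" by simp
  qed
qed (rule sv_bracket_bilinear sv_jacobi)+

end

(* Invariance makes every ad z skew-adjoint, so eigenvectors of ad z pair to zero unless their
   eigenvalues cancel. The eigenvalues of ad N_0 on L, N, Y, M are 0, 0, 1, 2, which leaves only the
   pairings among the L_n and N_n; these are killed by evaluating invariance on suitable triples. *)

theory Submission
  imports Defs
begin

locale sv_invariant_form =
  fixes f :: "sv \<Rightarrow> sv \<Rightarrow> complex"
  assumes bilinear: "bilinear_form sv_scale f"
    and invariant: "invariant_form sv_bracket f"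
begin

sublocale left: Vector_Spaces.linear sv_scale "(*)" "\<lambda>x. f x y" for y
  using bilinear by (simp add: bilinear_form_def bilinear_map_def)

sublocale right: Vector_Spaces.linear sv_scale "(*)" "f x" for x
  using bilinear by (simp add: bilinear_form_def bilinear_map_def)

lemmas form_simps [simp] =
  left.zero right.zero left.neg right.neg left.scale right.scale

lemma invariantD: "f (sv_bracket x y) z = f x (sv_bracket y z)"
  using invariant by (simp add: invariant_form_def)

text \<open>Antisymmetry first moves z to the right of x, where invariance can pass it to the other
  argument.\<close>

lemma bracket_skew: "f (sv_bracket z x) y = - f x (sv_bracket z y)"
  by (subst sv_bracket_antisym) (simp add: invariantD)

lemma eigenvectors_orthogonal:
  assumes "sv_bracket z x = sv_scale a x" "sv_bracket z y = sv_scale b y" "a + b \<noteq> 0"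
  shows "f x y = 0"
proof -
  have "(a + b) * f x y = 0"
    using bracket_skew [of z x y] assms by (simp add: distrib_right)
  then show ?thesis using assms by simp
qed

text \<open>Every N_m is a nonzero multiple of a bracket [L, N]; invariance then leaves a bracket of
  two N's, which is 0.\<close>

lemma form_NN: "f (sv_N m) (sv_N n) = 0"
proof -
  \<comment> \<open>Any nonzero k would do, since [L_(m-k), N_k] = k N_m.\<close>
  define k where "k = (if m = 0 then 1 else m)"
  have "of_int k * f (sv_N m) (sv_N n) = 0"
    using invariantD [of "sv_L (m - k)" "sv_N k" "sv_N n"] by simp
  then show ?thesis by (simp add: k_def split: if_splits)
qed

lemma form_LN: "f (sv_L m) (sv_N n) = 0"
proof -
  have rel: "of_int (b - c) * f (sv_L (c + b)) (sv_N a) = of_int a * f (sv_L c) (sv_N (b + a))"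
    for a b c
    using invariantD [of "sv_L c" "sv_L b" "sv_N a"] by simp
  have off: "f (sv_L i) (sv_N j) = 0" if "i \<noteq> j" for i j
    \<comment> \<open>Equal L-indices kill the left side, as [L_i, L_i] = 0; the right side keeps
      the factor j - i.\<close>
    using rel [of i i "j - i"] that by simp
  show ?thesis
  proof (cases "m = n")
    case True
    \<comment> \<open>A nonzero b moves the right side of \<open>rel\<close> off the diagonal. This
      choice also keeps 2b - n nonzero: it is n, or 2 if n = 0.\<close>
    define b where "b = (if n = 0 then 1 else n)"
    have "of_int (2 * b - n) * f (sv_L n) (sv_N n) = 0"
      using rel [of b "n - b" n] off [of "n - b" "b + n"] by (simp add: b_def split: if_splits)
    then show ?thesis using True by (simp add: b_def split: if_splits)
  qed (rule off)
qed

text \<open>Since f may fail to be symmetric, the mirrored argument is run on triples (N, L,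
  L).\<close>

lemma form_NL: "f (sv_N n) (sv_L m) = 0"
proof -
  have rel: "of_int (c - b) * f (sv_N a) (sv_L (b + c)) = - (of_int a * f (sv_N (b + a)) (sv_L c))"
    for a b c
    using invariantD [of "sv_N a" "sv_L b" "sv_L c"] by simp
  have off: "f (sv_N j) (sv_L i) = 0" if "i \<noteq> j" for i j
    using rel [of i i "j - i"] that by simp
  show ?thesis
  proof (cases "m = n")
    case True
    define b where "b = (if n = 0 then 1 else n)"
    have "of_int (n - 2 * b) * f (sv_N n) (sv_L n) = 0"
      using rel [of "n - b" b n] off [of "n - b" "b + n"] by (simp add: b_def split: if_splits)
    then show ?thesis using True by (simp add: b_def split: if_splits)
  qed (rule off)
qed

text \<open>Triples with two equal neighbouring or outer entries leave only pairs with m = 2n and n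
  = 2m, that is m = n = 0.\<close>

lemma form_LL: "f (sv_L m) (sv_L n) = 0"
proof -
  have rel: "of_int (b - a) * f (sv_L (a + b)) (sv_L c) = of_int (c - b) * f (sv_L a) (sv_L (b + c))"
    for a b c
    using invariantD [of "sv_L a" "sv_L b" "sv_L c"] by simp
  have off1: "f (sv_L i) (sv_L j) = 0" if "i \<noteq> 2 * j" for i j
    using rel [of j "i - j" j] that by (simp flip: of_int_diff)
  have off2: "f (sv_L i) (sv_L j) = 0" if "j \<noteq> 2 * i" for i j
    using rel [of i i "j - i"] that by (simp flip: of_int_diff)
  \<comment> \<open>The triple (L_1, L_(-1), L_0) ties this pairing, with factor -2, to the pair (1,
    -1), where \<open>off1\<close> applies.\<close>
  have "f (sv_L 0) (sv_L 0) = 0"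
    using rel [of "-1" 1 0] off1 [of 1 "-1"] by simp
  moreover have "m \<noteq> 2 * n \<or> n \<noteq> 2 * m \<or> m = 0 \<and> n = 0" by presburger
  ultimately show ?thesis using off1 off2 by blast
qed

text \<open>The values lie in \<open>nat\<close>, so a sum of two eigenvalues vanishes only if both
  do.\<close>

fun N_weight :: "sv_index \<Rightarrow> nat" where
  "N_weight (idxL n) = 0"
| "N_weight (idxN n) = 0"
| "N_weight (idxY n) = 1"
| "N_weight (idxM n) = 2"

lemma bracket_N0: "sv_bracket (sv_N 0) (sv_basis i) = sv_scale (of_nat (N_weight i)) (sv_basis i)"
  by (cases i) simp_all

lemma form_basis: "f (sv_basis i) (sv_basis j) = 0"
proof (cases "N_weight i + N_weight j = 0")
  case True
  then show ?thesis
    by (cases i; cases j) (simp_all add: form_LL form_LN form_NL form_NN)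
next
  case False
  then have "(of_nat (N_weight i) :: complex) + of_nat (N_weight j) \<noteq> 0"
    by (metis of_nat_add of_nat_eq_0_iff)
  then show ?thesis
    by (rule eigenvectors_orthogonal [OF bracket_N0 bracket_N0])
qed

lemma form_zero: "f x y = 0"
proof (induction x rule: sv_induct)
  case (basis i)
  show ?case
    by (induction y rule: sv_induct) (simp_all add: right.add form_basis)
qed (simp_all add: left.add)

end

theorem proposition4p1:
  shows "\<not> (\<exists>f :: sv \<Rightarrow> sv \<Rightarrow> complex.
    bilinear_form sv_scale f \<and> invariant_form sv_bracket f \<and> f \<noteq> (\<lambda>x y. 0))"
  using sv_invariant_form.form_zero unfolding sv_invariant_form_def by blast

end
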